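(* Let $E$ be a Hausdorff topological vector space, and let $\emptyset\neq X\subseteq Y\subseteq E$ with $Y$ convex. Let $\Gamma:X\to 2^{Y}$ be a set-valued map such that: (i) $\Gamma$ is a KKM map; (ii) for every $x\in X$, the set $\Gamma(x)$ is non-empty, convex, and closed in $Y$. Then the family $\{\Gamma(x)\}_{x\in X}$ has the finite intersection property, i.e. $\bigcap_{i=1}^{n}\Gamma(x_i)\neq\emptyset$ for every non-empty finite subset $\{x_1,\dots,x_n\}\subseteq X$. If, in addition, there exists a non-empty subset $X_0\subseteq X$ contained in a compact convex subset $D$ of $Y$ such that $\bigcap_{x\in X_0}\Gamma(x)$ is compact, then $\bigcap_{x\in X}\Gamma(x)\neq\emptyset$.
   Context: Vector spaces are real (or complex), and $\mathrm{conv}(S)$ denotes the convex hull of a set $S$. Given an arbitrary subset $X$ of a vector space $E$, a set-valued map $\Gamma:X\to 2^{E}$ is called a KKM map if for every finite subset $\{x_1,\dots,x_n\}\subseteq X$ one has $\mathrm{conv}(\{x_1,\dots,x_n\})\subseteq\bigcup_{i=1}^{n}\Gamma(x_i)$. A map into $2^{Y}$ with $Y\subseteq E$ is regarded as a map into $2^{E}$. *)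

theory Defs
  imports "HOL-Analysis.Analysis"
begin

text \<open>
  Topological vector spaces over the reals, not assumed Hausdorff or locally convex: joint
  continuity of scalar multiplication is stated in the same product-filter form that
  \<^class>\<open>topological_monoid_add\<close> uses for addition. A complex topological vector space is an
  instance by restriction of scalars; convexity involves real scalars only.
\<close>

class real_tvs = topological_ab_group_add + real_vector +
  assumes tendsto_scaleR_Pair:
    "LIM p (nhds a \<times>\<^sub>F nhds x). fst p *\<^sub>R snd p :> nhds (a *\<^sub>R x)"

lemma continuous_on_scaleR_tvs:
  "continuous_on UNIV (\<lambda>p :: real \<times> 'a::real_tvs. fst p *\<^sub>R snd p)"
  using tendsto_scaleR_Pair
  by (auto simp: continuous_on_def nhds_prod intro!: tendsto_mono[OF at_within_le_nhds])

instance real_normed_vector \<subseteq> real_tvs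
proof
  fix a :: real and x :: 'a
  have "((\<lambda>p. fst p *\<^sub>R snd p) \<longlongrightarrow> fst (a, x) *\<^sub>R snd (a, x)) (nhds (a, x))"
    by (intro tendsto_intros filterlim_ident)
  then show "LIM p (nhds a \<times>\<^sub>F nhds x). fst p *\<^sub>R snd p :> nhds (a *\<^sub>R x)"
    by (simp add: nhds_prod)
qed

text \<open>
  A set-valued map on \<open>X\<close> is a total function; its values outside \<open>X\<close> are irrelevant.
\<close>

definition kkm_map :: "'a::real_vector set \<Rightarrow> ('a \<Rightarrow> 'a set) \<Rightarrow> bool" where
  "kkm_map X \<Gamma> \<longleftrightarrow>
     (\<forall>F. finite F \<and> F \<subseteq> X \<longrightarrow> convex hull F \<subseteq> (\<Union>x\<in>F. \<Gamma> x))"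

end

theory Submission
  imports Defs
begin

text \<open>
  The finite case is by induction on the number of points: for each \<open>k\<close> the induction hypothesis
  gives a point \<open>y\<^sub>k\<close> of the hull of the other points lying in all \<open>\<Gamma> x\<^sub>i\<close> with \<open>i \<noteq> k\<close>, and a theorem of
  Klee applies: closed convex sets \<open>D\<^sub>i\<close> that cover the hull of the \<open>y\<^sub>k\<close>, where \<open>y\<^sub>k \<in> D\<^sub>i\<close> for
  \<open>i \<noteq> k\<close>, have a common point. Klee's theorem is pulled back to barycentric coordinates. There one
  minimises \<open>\<Sum>\<^sub>i |p\<^sub>i - m|\<^sup>2\<close> over all choices \<open>p\<^sub>i \<in> D\<^sub>i\<close>, where \<open>m\<close> is the mean of the \<open>p\<^sub>i\<close>. At a
  minimum each \<open>p\<^sub>i\<close> is the point of \<open>D\<^sub>i\<close> nearest to \<open>m\<close>, and \<open>m\<close> lies in some \<open>D\<^sub>k\<close>, so \<open>p\<^sub>k = m\<close>.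
  Testing the obtuse-angle condition at \<open>p\<^sub>i\<close> with \<open>y\<^sub>k\<close> for every \<open>i \<noteq> k\<close> and summing, the identity
  \<open>\<Sum>\<^sub>i (m - p\<^sub>i) = 0\<close> forces \<open>p\<^sub>i = m\<close> for all \<open>i\<close>.

  The induction yields the common point inside the hull of the chosen points. For the compact case
  this confines the common points of any finite subfamily of \<open>X\<^sub>0 \<union> F\<close>, with \<open>F\<close> finite, to the
  compact hull of \<open>F \<union> D\<close>; compactness is used once there and once in the intersection over \<open>X\<^sub>0\<close>.
\<close>

section \<open>Two inequalities for real numbers\<close>

lemma sum_square_dist_mean_le:
  fixes a :: "'i \<Rightarrow> real"
  assumes "finite I" and "I \<noteq> {}"
  shows "(\<Sum>i\<in>I. (a i - sum a I / card I)\<^sup>2) \<le> (\<Sum>i\<in>I. (a i - x)\<^sup>2)"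
proof -
  define M where "M = sum a I / card I"
  have n: "real (card I) > 0"
    using assms by (simp add: card_gt_0_iff)
  have M: "sum a I = card I * M"
    using n by (simp add: M_def)
  \<comment> \<open>Expansion around the mean: the cross term vanishes because deviations from the
    mean sum to zero.\<close>
  have "(\<Sum>i\<in>I. (a i - x)\<^sup>2) =
      (\<Sum>i\<in>I. (a i - M)\<^sup>2 + 2 * (M - x) * (a i - M) + (M - x)\<^sup>2)"
    by (intro sum.cong refl) (simp add: power2_eq_square algebra_simps)
  also have "\<dots> = (\<Sum>i\<in>I. (a i - M)\<^sup>2) + 2 * (M - x) * (sum a I - card I * M) + card I * (M - x)\<^sup>2"
    by (simp add: sum.distrib sum_subtractf flip: sum_distrib_left)
  finally show ?thesis
    using n by (simp add: M flip: M_def)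
qed

text \<open>Divide by \<open>t\<close> and let \<open>t\<close> tend to 0. With \<open>t\<close> the
  position on a segment, this turns a nearest-point property into an obtuse-angle condition.\<close>

lemma nonpos_if_quadratic_nonneg:
  fixes S Q :: real
  assumes "\<And>t. 0 \<le> t \<Longrightarrow> t \<le> 1 \<Longrightarrow> 2 * t * S \<le> t\<^sup>2 * Q" and "0 \<le> Q"
  shows "S \<le> 0"
proof (rule ccontr)
  assume "\<not> S \<le> 0"
  then have S: "S > 0" by simp
  \<comment> \<open>Small enough that \<open>t * (Q + 1)\<close> is at most \<open>S\<close>; the
    added 1 keeps the denominator positive when \<open>Q\<close> is 0.\<close>
  define t where "t = min 1 (S / (Q + 1))"
  have t: "0 < t" "t \<le> 1" "t \<le> S / (Q + 1)"
    using S assms(2) by (auto simp: t_def)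
  have "t * (2 * S) \<le> t * (t * Q)"
    using assms(1)[of t] t by (simp add: power2_eq_square mult_ac)
  then have "2 * S \<le> t * Q"
    using t by simp
  also have "\<dots> \<le> t * (Q + 1)"
    using t by simp
  also have "\<dots> \<le> S"
    using t(3) assms(2) by (simp add: field_simps)
  finally show False
    using S by simp
qed

section \<open>Klee's theorem in coordinates\<close>

lemma compact_PiE_UNIV:
  fixes P :: "'i \<Rightarrow> 'b::topological_space set"
  assumes "\<And>i. compact (P i)"
  shows "compact (PiE UNIV P)"
proof -
  have "compactin (product_topology (\<lambda>_. euclidean) UNIV) (PiE UNIV P)"
    using assms by (simp add: compactin_PiE)
  then show ?thesis
    by (simp add: euclidean_product_topology)
qed

lemma continuous_on_coord2 [continuous_intros]:
  "continuous_on S (\<lambda>p :: 'i \<Rightarrow> 'j \<Rightarrow> real. p i j)"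
proof -
  have "continuous_on UNIV (\<lambda>p :: 'i \<Rightarrow> 'j \<Rightarrow> real. p i j)"
    by (rule continuous_on_product_then_coordinatewise) simp
  then show ?thesis
    by (rule continuous_on_subset) simp
qed

text \<open>
  Function types carry no vector space structure here, so convexity of \<open>P i\<close> is spelled out
  coordinatewise, and the vanishing outside \<open>J\<close> makes the coordinates in \<open>J\<close> determine a point.
\<close>

lemma Klee_intersection_coordinates:
  fixes P :: "'i \<Rightarrow> ('j \<Rightarrow> real) set"
  assumes I: "finite I" "I \<noteq> {}" and J: "finite J"
    and comp: "\<And>i. i \<in> I \<Longrightarrow> compact (P i)"
    and ne: "\<And>i. i \<in> I \<Longrightarrow> P i \<noteq> {}"
    and supp: "\<And>i c j. i \<in> I \<Longrightarrow> c \<in> P i \<Longrightarrow> j \<notin> J \<Longrightarrow> c j = 0"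
    and seg: "\<And>i c d t. i \<in> I \<Longrightarrow> c \<in> P i \<Longrightarrow> d \<in> P i \<Longrightarrow> 0 \<le> t \<Longrightarrow> t \<le> 1 \<Longrightarrow>
      (\<lambda>j. c j + t * (d j - c j)) \<in> P i"
    and pt: "\<And>i k. i \<in> I \<Longrightarrow> k \<in> I \<Longrightarrow> i \<noteq> k \<Longrightarrow> e k \<in> P i"
    and mean: "\<And>p. (\<And>i. i \<in> I \<Longrightarrow> p i \<in> P i) \<Longrightarrow>
      \<exists>k\<in>I. (\<lambda>j. (\<Sum>i\<in>I. p i j) / card I) \<in> P k"
  shows "(\<Inter>i\<in>I. P i) \<noteq> {}"
proof -
  \<comment> \<open>The choices of one point from each \<open>P i\<close>; values outside
    \<open>I\<close> are pinned to zero so that \<open>W\<close> is a compact product.\<close>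
  define W where "W = PiE UNIV (\<lambda>i. if i \<in> I then P i else {\<lambda>_. 0})"
  define m where "m p j = (\<Sum>i\<in>I. p i j) / card I" for p :: "'i \<Rightarrow> 'j \<Rightarrow> real" and j
  define N where "N c d = (\<Sum>j\<in>J. (c j - d j)\<^sup>2)" for c d :: "'j \<Rightarrow> real"
  have W_iff: "q \<in> W \<longleftrightarrow> (\<forall>i. (i \<in> I \<longrightarrow> q i \<in> P i) \<and> (i \<notin> I \<longrightarrow> q i = (\<lambda>_. 0)))" for q
    by (simp add: W_def PiE_iff if_split_mem2)
  have W: "compact W"
    unfolding W_def by (rule compact_PiE_UNIV) (auto simp: comp)
  have "W \<noteq> {}"
    using ne by (auto simp: W_def PiE_eq_empty_iff)
  have "continuous_on W (\<lambda>p. \<Sum>i\<in>I. N (p i) (m p))"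
    unfolding N_def m_def using I by (intro continuous_intros) auto
  then obtain p where "p \<in> W" and
      pmin: "\<And>q. q \<in> W \<Longrightarrow> (\<Sum>i\<in>I. N (p i) (m p)) \<le> (\<Sum>i\<in>I. N (q i) (m q))"
    using continuous_attains_inf[OF W \<open>W \<noteq> {}\<close>] by blast
  have pP: "p i \<in> P i" if "i \<in> I" for i
    using \<open>p \<in> W\<close> that by (simp add: W_iff)
  have mean_le: "(\<Sum>i\<in>I. N (q i) (m q)) \<le> (\<Sum>i\<in>I. N (q i) c)" for q c
  proof -
    have "(\<Sum>j\<in>J. \<Sum>i\<in>I. (q i j - m q j)\<^sup>2) \<le> (\<Sum>j\<in>J. \<Sum>i\<in>I. (q i j - c j)\<^sup>2)"
      unfolding m_def by (intro sum_mono sum_square_dist_mean_le I)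
    then show ?thesis
      unfolding N_def by (simp add: sum.swap[of _ J I])
  qed
  have nearest: "N (p i) (m p) \<le> N q (m p)" if i: "i \<in> I" and q: "q \<in> P i" for i q
  proof -
    \<comment> \<open>Replacing one point also moves the mean, but \<open>mean_le\<close> allows
      comparison with the old mean, and then only the terms at \<open>i\<close> differ.\<close>
    have "p(i := q) \<in> W"
      using \<open>p \<in> W\<close> i q by (simp add: W_iff)
    then have "(\<Sum>k\<in>I. N (p k) (m p)) \<le> (\<Sum>k\<in>I. N ((p(i := q)) k) (m p))"
      using pmin mean_le order_trans by blast
    then show ?thesis
      using I i by (simp add: sum.remove[of I i])
  qed
  have angle: "(\<Sum>j\<in>J. (m p j - p i j) * (z j - p i j)) \<le> 0" if i: "i \<in> I" and z: "z \<in> P i" for i z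
  proof (rule nonpos_if_quadratic_nonneg)
    fix t :: real assume t: "0 \<le> t" "t \<le> 1"
    have "N (p i) (m p) \<le> N (\<lambda>j. p i j + t * (z j - p i j)) (m p)"
      using i z t by (intro nearest seg pP)
    also have "\<dots> = N (p i) (m p) - 2 * t * (\<Sum>j\<in>J. (m p j - p i j) * (z j - p i j))
        + t\<^sup>2 * (\<Sum>j\<in>J. (z j - p i j)\<^sup>2)"
      by (simp add: N_def sum_distrib_left power2_eq_square algebra_simps
          flip: sum.distrib sum_subtractf)
    finally show "2 * t * (\<Sum>j\<in>J. (m p j - p i j) * (z j - p i j)) \<le> t\<^sup>2 * (\<Sum>j\<in>J. (z j - p i j)\<^sup>2)"
      by simp
  qed (simp add: sum_nonneg)
  \<comment> \<open>\<open>N\<close> sees only coordinates in \<open>J\<close>; \<open>supp\<close>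
    settles the others.\<close>
  have N0: "c = d" if "c \<in> P i" "d \<in> P k" "i \<in> I" "k \<in> I" "N c d \<le> 0" for c d i k
  proof
    fix j
    have "N c d = 0"
      using that(5) by (simp add: N_def sum_nonneg antisym)
    then show "c j = d j"
      using supp[OF that(3,1)] supp[OF that(4,2)] J
      by (cases "j \<in> J") (simp_all add: N_def sum_nonneg_eq_0_iff)
  qed
  obtain k where k: "k \<in> I" "m p \<in> P k"
    using mean[OF pP] by (auto simp: m_def[abs_def])
  have "N (p k) (m p) \<le> 0"
    using nearest[OF k] by (simp add: N_def)
  then have pk: "p k = m p"
    using N0[OF pP[OF k(1)] k(2) k(1) k(1)] by simp
  have le: "N (p i) (m p) \<le> - (\<Sum>j\<in>J. (m p j - p i j) * (e k j - m p j))" if i: "i \<in> I" for i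
  proof (cases "i = k")
    case True
    then show ?thesis by (simp add: pk N_def)
  next
    case False
    have "N (p i) (m p) + (\<Sum>j\<in>J. (m p j - p i j) * (e k j - m p j)) =
        (\<Sum>j\<in>J. (m p j - p i j) * (e k j - p i j))"
      by (simp add: N_def power2_eq_square algebra_simps flip: sum.distrib)
    also have "\<dots> \<le> 0"
      using angle[OF i pt[OF i k(1) False]] .
    finally show ?thesis by simp
  qed
  have "(\<Sum>i\<in>I. N (p i) (m p)) \<le> (\<Sum>i\<in>I. - (\<Sum>j\<in>J. (m p j - p i j) * (e k j - m p j)))"
    by (intro sum_mono le)
  also have "\<dots> = - (\<Sum>j\<in>J. (\<Sum>i\<in>I. m p j - p i j) * (e k j - m p j))"
    by (simp add: sum_negf sum.swap[of _ I J] sum_distrib_right)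
  also have "\<dots> = 0"
    using I by (simp add: sum_subtractf m_def)
  finally have "(\<Sum>i\<in>I. N (p i) (m p)) \<le> 0" .
  moreover have "\<And>i. 0 \<le> N (p i) (m p)"
    by (simp add: N_def sum_nonneg)
  ultimately have "N (p i) (m p) \<le> 0" if "i \<in> I" for i
    using member_le_sum[of i I "\<lambda>i. N (p i) (m p)"] I that by fastforce
  then have "m p \<in> P i" if "i \<in> I" for i
    using N0[OF pP k(2)] pP k(1) that by metis
  then show ?thesis by blast
qed

section \<open>Transfer of Klee's theorem to topological vector spaces\<close>

definition unit_simplex :: "'i set \<Rightarrow> ('i \<Rightarrow> real) set" where
  "unit_simplex I = {c. (\<forall>i\<in>I. 0 \<le> c i) \<and> (\<forall>i. i \<notin> I \<longrightarrow> c i = 0) \<and> sum c I = 1}"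

lemma compact_unit_simplex:
  assumes "finite I"
  shows "compact (unit_simplex I)"
proof -
  \<comment> \<open>Non-negative coordinates with sum 1 are at most 1, so the simplex is a closed
    slice of a compact box.\<close>
  have "unit_simplex I = PiE UNIV (\<lambda>i. if i \<in> I then {0..1} else {0}) \<inter> {c. sum c I = 1}"
    using member_le_sum[of _ I] assms
    by (fastforce simp: unit_simplex_def PiE_def Pi_def split: if_splits)
  moreover have "closed {c :: 'a \<Rightarrow> real. sum c I = 1}"
    by (intro closed_Collect_eq continuous_intros continuous_on_product_coordinates)
  moreover have "compact (PiE UNIV (\<lambda>i. if i \<in> I then {0..1} else {0::real}))"
    by (rule compact_PiE_UNIV) auto
  ultimately show ?thesis
    by (metis compact_Int_closed)
qed

lemma continuous_on_scaleR_tvs_compose: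
  fixes g :: "'a::topological_space \<Rightarrow> 'b::real_tvs"
  assumes "continuous_on S f" and "continuous_on S g"
  shows "continuous_on S (\<lambda>x. f x *\<^sub>R g x)"
  using continuous_on_compose2[OF continuous_on_scaleR_tvs continuous_on_Pair[OF assms]] by simp

lemma convex_hull_image_eq_unit_simplex:
  fixes y :: "'i \<Rightarrow> 'a::real_vector"
  assumes I: "finite I"
  shows "convex hull (y ` I) = (\<lambda>c. \<Sum>i\<in>I. c i *\<^sub>R y i) ` unit_simplex I" (is "_ = ?R")
proof
  show "?R \<subseteq> convex hull (y ` I)"
  proof clarify
    fix c assume "c \<in> unit_simplex I"
    then show "(\<Sum>i\<in>I. c i *\<^sub>R y i) \<in> convex hull (y ` I)"
      by (intro convex_sum[OF I convex_convex_hull]) (auto simp: unit_simplex_def hull_inc)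
  qed
  show "convex hull (y ` I) \<subseteq> ?R"
  proof (rule hull_minimal)
    show "y ` I \<subseteq> ?R"
    proof clarify
      fix k assume "k \<in> I"
      then show "y k \<in> ?R"
        using I by (intro image_eqI[of _ _ "\<lambda>i. of_bool (i = k)"])
          (auto simp: unit_simplex_def if_distrib[of "\<lambda>x. x *\<^sub>R _"] of_bool_def cong: if_cong)
    qed
    show "convex ?R"
    proof (rule convexI, clarify)
      fix c d and u v :: real
      assume "c \<in> unit_simplex I" "d \<in> unit_simplex I" "0 \<le> u" "0 \<le> v" "u + v = 1"
      then show "u *\<^sub>R (\<Sum>i\<in>I. c i *\<^sub>R y i) + v *\<^sub>R (\<Sum>i\<in>I. d i *\<^sub>R y i) \<in> ?R"
        by (intro image_eqI[of _ _ "\<lambda>i. u * c i + v * d i"])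
          (auto simp: unit_simplex_def scaleR_sum_right scaleR_left_distrib sum.distrib
            simp flip: sum_distrib_left)
    qed
  qed
qed

text \<open>The simplex supplies the Euclidean distance that the space lacks. The barycentric map
  need not be injective, as only the image of a common point is needed.\<close>

lemma Klee_intersection:
  fixes y :: "'i \<Rightarrow> 'a::real_tvs"
  assumes I: "finite I" "I \<noteq> {}" and Y: "convex Y" "y ` I \<subseteq> Y"
    and D: "\<And>i. i \<in> I \<Longrightarrow> convex (D i)" "\<And>i. i \<in> I \<Longrightarrow> closedin (top_of_set Y) (D i)"
    and pt: "\<And>i k. i \<in> I \<Longrightarrow> k \<in> I \<Longrightarrow> i \<noteq> k \<Longrightarrow> y k \<in> D i"
    and cover: "convex hull (y ` I) \<subseteq> (\<Union>i\<in>I. D i)"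
  shows "convex hull (y ` I) \<inter> (\<Inter>i\<in>I. D i) \<noteq> {}"
proof -
  define \<phi> where "\<phi> c = (\<Sum>i\<in>I. c i *\<^sub>R y i)" for c
  define P where "P i = {c \<in> unit_simplex I. \<phi> c \<in> D i}" for i
  define e :: "'i \<Rightarrow> 'i \<Rightarrow> real" where "e k = (\<lambda>i. of_bool (i = k))" for k
  have hull: "convex hull (y ` I) = \<phi> ` unit_simplex I"
    unfolding \<phi>_def[abs_def] by (rule convex_hull_image_eq_unit_simplex[OF I(1)])
  have hullY: "convex hull (y ` I) \<subseteq> Y"
    using Y by (simp add: hull_minimal)
  have e: "e k \<in> unit_simplex I" "\<phi> (e k) = y k" if "k \<in> I" for k
    using that I(1)
    by (auto simp: e_def \<phi>_def unit_simplex_def if_distrib[of "\<lambda>x. x *\<^sub>R _"] of_bool_def cong: if_cong)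
  have cont: "continuous_on (unit_simplex I) \<phi>"
    unfolding \<phi>_def[abs_def]
    by (intro continuous_on_sum continuous_on_scaleR_tvs_compose continuous_on_const
        continuous_on_subset[OF continuous_on_product_coordinates]) simp
  have "(\<Inter>i\<in>I. P i) \<noteq> {}"
  proof (rule Klee_intersection_coordinates[OF I I(1)])
    fix i assume i: "i \<in> I"
    obtain T where T: "closed T" "D i = Y \<inter> T"
      using D(2)[OF i] by (auto simp: closedin_closed)
    \<comment> \<open>The hull lies in \<open>Y\<close>, so on the simplex \<open>D i\<close> may be
      replaced by the closed set \<open>T\<close>.\<close>
    have "P i = unit_simplex I \<inter> \<phi> -` T"
      using hullY hull by (auto simp: P_def T)
    moreover have "closedin (top_of_set (unit_simplex I)) (unit_simplex I \<inter> \<phi> -` T)"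
      using cont T(1) by (rule continuous_closedin_preimage)
    ultimately show "compact (P i)"
      using closedin_compact compact_unit_simplex[OF I(1)] by metis
    show "P i \<noteq> {}"
    \<comment> \<open>With a single index no other \<open>y k\<close> is available, and the cover
      supplies the point.\<close>
    proof (cases "I = {i}")
      case True
      then have "y i \<in> D i"
        using cover by auto
      then show ?thesis using e[OF i] by (auto simp: P_def)
    next
      case False
      then obtain k where k: "k \<in> I" "i \<noteq> k" using i by blast
      then have "e k \<in> P i" using e[OF k(1)] pt[OF i k] by (simp add: P_def)
      then show ?thesis by blast
    qed
    show "c j = 0" if "c \<in> P i" "j \<notin> I" for c j
      using that by (auto simp: P_def unit_simplex_def)
    show "e k \<in> P i" if "k \<in> I" "i \<noteq> k" for k
      using that e pt[OF i] by (auto simp: P_def)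
    show "(\<lambda>j. c j + t * (d j - c j)) \<in> P i"
      if c: "c \<in> P i" and d: "d \<in> P i" and t: "0 \<le> t" "t \<le> 1" for c d t
    proof -
      have "0 \<le> (1 - t) * c j + t * d j" if "j \<in> I" for j
        using c d t that by (auto simp: P_def unit_simplex_def)
      then have "(\<lambda>j. c j + t * (d j - c j)) \<in> unit_simplex I"
        using c d by (auto simp: P_def unit_simplex_def sum.distrib sum_subtractf algebra_simps
            simp flip: sum_distrib_left)
      moreover have "\<phi> (\<lambda>j. c j + t * (d j - c j)) = (1 - t) *\<^sub>R \<phi> c + t *\<^sub>R \<phi> d"
        by (simp add: \<phi>_def scaleR_sum_right algebra_simps sum.distrib sum_subtractf)
      moreover have "(1 - t) *\<^sub>R \<phi> c + t *\<^sub>R \<phi> d \<in> D i"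
        using c d t D(1)[OF i] by (auto simp: P_def intro: convexD)
      ultimately show ?thesis by (simp add: P_def)
    qed
  next
    fix p assume "\<And>i. i \<in> I \<Longrightarrow> p i \<in> P i"
    then have p: "p i \<in> unit_simplex I" if "i \<in> I" for i
      using that by (auto simp: P_def)
    \<comment> \<open>The mean stays in the simplex, so its image is in the hull and hence in some
      \<open>D k\<close>.\<close>
    have "(\<Sum>j\<in>I. \<Sum>i\<in>I. p i j) = card I"
      using p by (subst sum.swap) (simp add: unit_simplex_def)
    then have "(\<lambda>j. (\<Sum>i\<in>I. p i j) / card I) \<in> unit_simplex I"
      using p I by (auto simp: unit_simplex_def sum_nonneg simp flip: sum_divide_distrib)
    then show "\<exists>k\<in>I. (\<lambda>j. (\<Sum>i\<in>I. p i j) / card I) \<in> P k"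
      using cover hull by (auto simp: P_def)
  qed
  then show ?thesis
    using I(2) hull by (fastforce simp: P_def)
qed

section \<open>Finite families\<close>

lemma kkm_map_finite_Inter_convex_hull:
  fixes \<Gamma> :: "'a::real_tvs \<Rightarrow> 'a set"
  assumes Y: "convex Y"
    and "finite F" "F \<noteq> {}" "F \<subseteq> Y" "kkm_map F \<Gamma>"
    and "\<And>x. x \<in> F \<Longrightarrow> convex (\<Gamma> x)"
    and "\<And>x. x \<in> F \<Longrightarrow> closedin (top_of_set Y) (\<Gamma> x)"
  shows "convex hull F \<inter> (\<Inter>x\<in>F. \<Gamma> x) \<noteq> {}"
  using assms(2-)
proof (induction "card F" arbitrary: F rule: less_induct)
  case less
  have kkm: "convex hull G \<subseteq> (\<Union>x\<in>G. \<Gamma> x)" if "G \<subseteq> F" for G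
    using less.prems(4) that finite_subset[OF that less.prems(1)] unfolding kkm_map_def by blast
  show ?case
  proof (cases "\<exists>x. F = {x}")
    case True
    then show ?thesis using kkm[of F] by auto
  next
    case False
    have "\<exists>z. z \<in> convex hull (F - {k}) \<and> (\<forall>x\<in>F - {k}. z \<in> \<Gamma> x)" if "k \<in> F" for k
    proof -
      have "convex hull (F - {k}) \<inter> (\<Inter>x\<in>F - {k}. \<Gamma> x) \<noteq> {}"
      proof (rule less.hyps)
        show "card (F - {k}) < card F"
          using less.prems(1) that by (rule card_Diff1_less)
        show "F - {k} \<noteq> {}" using False that by blast
        show "kkm_map (F - {k}) \<Gamma>"
          using less.prems(4) unfolding kkm_map_def by blast
      qed (use less.prems in auto)
      then show ?thesis by blast
    qed
    then have "\<forall>k\<in>F. \<exists>z. z \<in> convex hull (F - {k}) \<and> (\<forall>x\<in>F - {k}. z \<in> \<Gamma> x)"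
      by blast
    from bchoice[OF this] obtain y where y: "\<And>k. k \<in> F \<Longrightarrow> y k \<in> convex hull (F - {k})"
        "\<And>k x. k \<in> F \<Longrightarrow> x \<in> F \<Longrightarrow> x \<noteq> k \<Longrightarrow> y k \<in> \<Gamma> x"
      by blast
    \<comment> \<open>The new points stay in the hull of \<open>F\<close>, so the KKM property
      provides the cover for Klee's theorem.\<close>
    have "y k \<in> convex hull F" if "k \<in> F" for k
      using y(1)[OF that] hull_mono[of "F - {k}" F] by blast
    then have hull: "convex hull (y ` F) \<subseteq> convex hull F"
      by (intro hull_minimal) auto
    have "convex hull F \<subseteq> Y"
      using Y less.prems(3) by (simp add: hull_minimal)
    have "convex hull (y ` F) \<inter> (\<Inter>x\<in>F. \<Gamma> x) \<noteq> {}"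
    proof (rule Klee_intersection)
      show "y ` F \<subseteq> Y"
        using hull hull_subset[of "y ` F" convex] \<open>convex hull F \<subseteq> Y\<close> by blast
      show "convex hull (y ` F) \<subseteq> (\<Union>x\<in>F. \<Gamma> x)"
        using hull kkm[of F] by blast
    qed (use less.prems Y y in auto)
    then show ?thesis using hull by blast
  qed
qed

section \<open>Compact hulls and infinite families\<close>

lemma compact_convex_hull_insert:
  fixes D :: "'a::real_tvs set"
  assumes "compact D" "convex D" "D \<noteq> {}"
  shows "compact (convex hull (insert a D))"
proof -
  \<comment> \<open>As \<open>D\<close> is convex, the hull consists of the segments from
    \<open>a\<close> to \<open>D\<close>, a continuous image of a compact product.\<close>
  have "convex hull (insert a D) = (\<lambda>(t, x). (1 - t) *\<^sub>R a + t *\<^sub>R x) ` ({0..1} \<times> D)" (is "?L = ?R")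
  proof
    show "?L \<subseteq> ?R"
    proof
      fix x assume "x \<in> ?L"
      then obtain u v b where "0 \<le> u" "0 \<le> v" "u + v = 1" "b \<in> D" "x = u *\<^sub>R a + v *\<^sub>R b"
        using assms by (auto simp: convex_hull_insert hull_same)
      then have "u = 1 - v" by simp
      with \<open>0 \<le> u\<close> \<open>0 \<le> v\<close> \<open>b \<in> D\<close> \<open>x = u *\<^sub>R a + v *\<^sub>R b\<close> show "x \<in> ?R"
        by (intro image_eqI[of _ _ "(v, b)"]) auto
    qed
    show "?R \<subseteq> ?L"
      by (auto simp: hull_inc intro!: convexD[OF convex_convex_hull])
  qed
  moreover have "continuous_on ({0..1} \<times> D) (\<lambda>(t, x). (1 - t) *\<^sub>R a + t *\<^sub>R x)"
    unfolding case_prod_unfold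
    by (intro continuous_on_add continuous_on_scaleR_tvs_compose continuous_intros)
  ultimately show ?thesis
    using assms by (simp add: compact_continuous_image compact_Times)
qed

text \<open>Points are added one at a time to a hull already compact and convex. Hulls of arbitrary
  compact sets need not be compact.\<close>

lemma compact_convex_hull_Un_finite:
  fixes D :: "'a::real_tvs set"
  assumes "finite F" "compact D" "convex D" "D \<noteq> {}"
  shows "compact (convex hull (F \<union> D))"
  using assms(1)
proof induction
  case empty
  then show ?case using assms by (simp add: hull_same)
next
  case (insert a F)
  have "convex hull (insert a F \<union> D) = convex hull (insert a (convex hull (F \<union> D)))"
    by (metis Un_insert_left hull_insert)
  then show ?case
    using insert.IH assms by (simp add: compact_convex_hull_insert)
qed

theorem theorem6:
  fixes X Y :: "'e::{real_tvs, t2_space} set"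
    and \<Gamma> :: "'e \<Rightarrow> 'e set"
  assumes "X \<noteq> {}" and "X \<subseteq> Y" and "convex Y"
    and "\<And>x. x \<in> X \<Longrightarrow> \<Gamma> x \<subseteq> Y"
    and "kkm_map X \<Gamma>"
    and "\<And>x. x \<in> X \<Longrightarrow> \<Gamma> x \<noteq> {}"
    and "\<And>x. x \<in> X \<Longrightarrow> convex (\<Gamma> x)"
    and "\<And>x. x \<in> X \<Longrightarrow> closedin (top_of_set Y) (\<Gamma> x)"
  shows "(\<forall>F. finite F \<and> F \<noteq> {} \<and> F \<subseteq> X \<longrightarrow> (\<Inter>x\<in>F. \<Gamma> x) \<noteq> {}) \<and>
    ((\<exists>X\<^sub>0 D. X\<^sub>0 \<noteq> {} \<and> X\<^sub>0 \<subseteq> X \<and> X\<^sub>0 \<subseteq> D \<and> D \<subseteq> Y \<and> compact D \<and> convex D \<and>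
        compact (\<Inter>x\<in>X\<^sub>0. \<Gamma> x))
      \<longrightarrow> (\<Inter>x\<in>X. \<Gamma> x) \<noteq> {})"
proof (intro conjI impI allI)
  have fin: "convex hull F \<inter> (\<Inter>x\<in>F. \<Gamma> x) \<noteq> {}" if F: "finite F" "F \<noteq> {}" "F \<subseteq> X" for F
  proof (rule kkm_map_finite_Inter_convex_hull[OF assms(3)])
    show "kkm_map F \<Gamma>"
      using assms(5) F unfolding kkm_map_def by blast
  qed (use F assms in auto)
  then show "(\<Inter>x\<in>F. \<Gamma> x) \<noteq> {}" if "finite F \<and> F \<noteq> {} \<and> F \<subseteq> X" for F
    using that by blast
  assume "\<exists>X\<^sub>0 D. X\<^sub>0 \<noteq> {} \<and> X\<^sub>0 \<subseteq> X \<and> X\<^sub>0 \<subseteq> D \<and> D \<subseteq> Y \<and> compact D \<and> convex D \<and>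
      compact (\<Inter>x\<in>X\<^sub>0. \<Gamma> x)"
  then obtain X\<^sub>0 D where X0: "X\<^sub>0 \<noteq> {}" "X\<^sub>0 \<subseteq> X" "X\<^sub>0 \<subseteq> D"
    and D: "D \<subseteq> Y" "compact D" "convex D" and K: "compact (\<Inter>x\<in>X\<^sub>0. \<Gamma> x)"
    by blast
  \<comment> \<open>Compactness needs sets closed in the whole space; membership in \<open>Y\<close>
    is restored separately.\<close>
  have "\<forall>x\<in>X. \<exists>T. closed T \<and> \<Gamma> x = Y \<inter> T"
    using assms(8) unfolding closedin_closed by blast
  then obtain T where T: "\<And>x. x \<in> X \<Longrightarrow> closed (T x)" "\<And>x. x \<in> X \<Longrightarrow> \<Gamma> x = Y \<inter> T x"
    by metis
  have "(\<Inter>x\<in>X\<^sub>0. \<Gamma> x) \<inter> (\<Inter>x\<in>X. T x) \<noteq> {}"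
  proof (rule compact_imp_fip_image[OF K T(1)])
    fix F assume F: "finite F" "F \<subseteq> X"
    define C where "C = convex hull (F \<union> D)"
    have "compact C"
      unfolding C_def using F D X0 by (intro compact_convex_hull_Un_finite) auto
    have "C \<subseteq> Y"
      unfolding C_def using F D assms(2,3) by (intro hull_minimal) auto
    \<comment> \<open>\<open>X\<^sub>0\<close> may be infinite, so the finite case reaches
      \<open>X\<^sub>0 \<union> F\<close> only through compactness of \<open>C\<close>.\<close>
    have "C \<inter> (\<Inter>x\<in>X\<^sub>0 \<union> F. T x) \<noteq> {}"
    proof (rule compact_imp_fip_image[OF \<open>compact C\<close>])
      show "closed (T x)" if "x \<in> X\<^sub>0 \<union> F" for x
        using T(1) X0 F that by blast
      fix A assume A: "finite A" "A \<subseteq> X\<^sub>0 \<union> F"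
      \<comment> \<open>Inserting \<open>x\<close> keeps the family non-empty when \<open>A\<close>
        is empty, and the hull still lies in \<open>C\<close>.\<close>
      obtain x where x: "x \<in> X\<^sub>0" using X0 by blast
      have "convex hull (insert x A) \<inter> (\<Inter>x\<in>insert x A. \<Gamma> x) \<noteq> {}"
        using A x X0 F by (intro fin) auto
      then obtain z where z: "z \<in> convex hull (insert x A)" "\<And>x. x \<in> A \<Longrightarrow> z \<in> \<Gamma> x"
        by auto
      have "convex hull (insert x A) \<subseteq> C"
        unfolding C_def using A x X0 by (intro hull_mono) auto
      then have "z \<in> C"
        using z(1) by blast
      moreover have "z \<in> T w" if "w \<in> A" for w
        using T(2)[of w] z(2)[OF that] A X0 F that by blast
      ultimately show "C \<inter> (\<Inter>x\<in>A. T x) \<noteq> {}"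
        by (intro ex_in_conv[THEN iffD1] exI[of _ z]) simp
    qed
    then obtain z where z: "z \<in> C" "\<And>x. x \<in> X\<^sub>0 \<union> F \<Longrightarrow> z \<in> T x"
      by blast
    then have "z \<in> \<Gamma> x" if "x \<in> X\<^sub>0" for x
      using that T(2)[of x] X0 \<open>C \<subseteq> Y\<close> by blast
    with z show "(\<Inter>x\<in>X\<^sub>0. \<Gamma> x) \<inter> (\<Inter>x\<in>F. T x) \<noteq> {}"
      by (intro ex_in_conv[THEN iffD1] exI[of _ z]) simp
  qed
  then obtain z where z: "\<And>x. x \<in> X\<^sub>0 \<Longrightarrow> z \<in> \<Gamma> x" "\<And>x. x \<in> X \<Longrightarrow> z \<in> T x"
    by blast
  have "z \<in> Y"
    using X0 z(1) assms(4) by blast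
  then show "(\<Inter>x\<in>X. \<Gamma> x) \<noteq> {}"
    using z(2) T(2) by blast
qed

end
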